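(* Let $\bar y$ be the given linearization point, let $v\in Y$ solve $(\partial_t-A-C)v=A\bar y-N(\bar y)$, $v(0)=y_0-\bar y_0$, let $w$ solve $(\partial_t-A-C)w=0$, $w(0)=F$, let $u\in U$ be arbitrary, and let $d^{(1)}\in Y$ solve $(\partial_t-A-C)d^{(1)}=A\bar y-N(\bar y)+Fu$, $d^{(1)}(0)=y_0-\bar y_0$. Then for $t\in[0,T]$ $$d^{(1)}(t)-v(t)\in\overline{\operatorname{span}\, w([0,T])}^{W},$$ where $w([0,T])$ denotes the essential range of $w$. The discrete analogs $(d^{(1)}_k)$, $(v_k)$ and $(w_k)$ for the $\theta$-scheme, that is, the solutions of (for $0\le k<K$) $$\frac{d^{(1)}_{k+1}-d^{(1)}_k}{\Delta t}-(A+C)(\theta d^{(1)}_{k+1}+(1-\theta)d^{(1)}_k)=A\bar y-N(\bar y)+Fu_k,\quad d^{(1)}_0=y_0-\bar y_0,$$ $$\frac{v_{k+1}-v_k}{\Delta t}-(A+C)(\theta v_{k+1}+(1-\theta)v_k)=A\bar y-N(\bar y),\quad v_0=y_0-\bar y_0,$$ $$\frac{w_{k+1}-w_k}{\Delta t}-(A+C)(\theta w_{k+1}+(1-\theta)w_k)=0,\quad (I+\Delta t(1-\theta)(A+C))w_0=F,$$ satisfy $d^{(1)}_k-v_k\in\operatorname{span}\{w_1,\dots,w_k\}$.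
   Context: Setting: $T>0$; $V\hookrightarrow W\hookrightarrow H$ are Hilbert spaces with dense embeddings; $y_0\in W$, $F\in H$, $U=L^2(0,T)$ (real-valued controls; $Fu$ denotes $t\mapsto u(t)F$). $Y,Z$ are Banach spaces with $Y\hookrightarrow L^2(0,T;V)\cap C([0,T],H)$ and $Z\hookrightarrow L^2(0,T;H)\times W$ (boundary conditions are included in the definition of $Y$). $A$ is an elliptic (linear) spatial operator, $N$ a nonlinear term of lower order, and the operator $E:Y\times U\to Z$, $E(y,u)=(\partial_t y-Ay+N(y)-Fu,\;y(0)-y_0)$, in which $u$ enters linearly, is continuously Fréchet differentiable with $E_y(y,u)\in\mathcal L(Y,Z)$ invertible for all $(y,u)\in Y\times U$. For every time-independent $\bar y\in Y$ the operator $A-N_y(\bar y)$ generates a strongly continuous semigroup $(T(t))_{t\ge0}$ on $H$. A linearization point $\bar y\in Y$ of $E$, constant in time, $\bar y(t)=\bar y_0$ with $\bar y_0\in V$, is fixed, and $C:=-N_y(\bar y)$. Solutions of $(\partial_t-A-C)z=f$, $z(0)=z_0$ are represented as mild solutions $z(t)=T(t)z_0+\int_0^tT(t-s)f(s)\,ds$; in particular $w(t)=T(t)F$, $w\in C([0,T];H)$. Essential range: for a function $f\in L^p(0,T;X)$, $X$ some Banach space, $f([0,T]):=\bigcap_{M\subset[0,T],\,\lambda(M)=0}\overline{\{f(t)\mid t\in[0,T]\setminus M\}}^{X}$, where $\lambda$ is Lebesgue measure. The notation $\overline{\,\cdot\,}^{W}$ denotes closure in $W$. Discretization: $\theta\in[\frac12,1]$,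 $0=t_0<\dots<t_K=T$ is a uniform time grid with $\Delta t=t_{k+1}-t_k$, and $(u_k)_{k\in\{0,\dots,K-1\}}$ is an interval-wise constant discretization of the control $u$.
   Formalization: The first part is proved under the added assumption that w lies in L²(0,T;W), with its essential range taken in W (it is false without such an assumption); the second part assumes that each step of the θ-scheme has at most one solution. *)

theory Defs
  imports "HOL-Analysis.Analysis"
begin

section \<open>Functions on \<open>[0,T]\<close> with values in a normed space\<close>

text \<open>
  The Hilbert spaces are not assumed to be separable, so Borel measurability is replaced by
  Bochner's strong measurability (almost everywhere limit of simple functions), and vector-valued
  integrals are gauge integrals (\<open>has_integral\<close>), since the library's Bochner integral
  requires a second countable range. A Bochner integrable function on a compact interval is
  gauge integrable with the same integral.
\<close>

definition strongly_measurable :: "'a measure \<Rightarrow> ('a \<Rightarrow> 'b::real_normed_vector) \<Rightarrow> bool" where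
  "strongly_measurable M f \<longleftrightarrow>
     (\<exists>s. (\<forall>i::nat. simple_function M (s i)) \<and> (AE x in M. (\<lambda>i. s i x) \<longlonglongrightarrow> f x))"

definition in_L2 :: "real \<Rightarrow> (real \<Rightarrow> 'b::real_normed_vector) \<Rightarrow> bool" where
  "in_L2 T f \<longleftrightarrow> strongly_measurable (lebesgue_on {0..T}) f
     \<and> integrable (lebesgue_on {0..T}) (\<lambda>t. (norm (f t))\<^sup>2)"

definition L2_norm :: "real \<Rightarrow> (real \<Rightarrow> 'b::real_normed_vector) \<Rightarrow> real" where
  "L2_norm T f = sqrt (LINT t|lebesgue_on {0..T}. (norm (f t))\<^sup>2)"

text \<open>
  The closure is taken in the space of values \<open>'b\<close>. Changing \<open>f\<close> on a null set does not change
  its essential range.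
\<close>

definition essential_range :: "real \<Rightarrow> (real \<Rightarrow> 'b::real_normed_vector) \<Rightarrow> 'b set" where
  "essential_range T f =
     (\<Inter>M\<in>{M. M \<subseteq> {0..T} \<and> M \<in> null_sets lebesgue}. closure (f ` ({0..T} - M)))"

text \<open>Weak time derivative: \<open>y(t) = y(0) + \<integral>\<^sub>0\<^sup>t g(s) ds\<close>.\<close>

definition has_time_derivative ::
  "real \<Rightarrow> (real \<Rightarrow> 'b::real_normed_vector) \<Rightarrow> (real \<Rightarrow> 'b) \<Rightarrow> bool" where
  "has_time_derivative T y g \<longleftrightarrow> (\<forall>t\<in>{0..T}. (g has_integral (y t - y 0)) {0..t})"

section \<open>Semigroups and mild solutions\<close>

definition C0_semigroup :: "(real \<Rightarrow> 'h::real_normed_vector \<Rightarrow>\<^sub>L 'h) \<Rightarrow> bool" where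
  "C0_semigroup S \<longleftrightarrow> S 0 = id_blinfun
     \<and> (\<forall>s\<ge>0. \<forall>t\<ge>0. S (s + t) = S s o\<^sub>L S t)
     \<and> (\<forall>x. continuous_on {0..} (\<lambda>t. blinfun_apply (S t) x))"

definition generator_graph :: "(real \<Rightarrow> 'h::real_normed_vector \<Rightarrow>\<^sub>L 'h) \<Rightarrow> ('h \<times> 'h) set" where
  "generator_graph S =
     {(x, z). ((\<lambda>r. (blinfun_apply (S r) x - x) /\<^sub>R r) \<longlongrightarrow> z) (at_right 0)}"

text \<open>
  The operator \<open>L\<close>, defined on a set \<open>D\<close> of elements of \<open>V\<close> and taking values in \<open>H\<close>, is viewed as
  an unbounded operator in \<open>H\<close> via the embedding \<open>j\<close> of \<open>V\<close> into \<open>H\<close>.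
\<close>

definition generates ::
  "('v::real_normed_vector \<Rightarrow>\<^sub>L 'h::real_normed_vector) \<Rightarrow> 'v set \<Rightarrow> ('v \<Rightarrow> 'h)
     \<Rightarrow> (real \<Rightarrow> 'h \<Rightarrow>\<^sub>L 'h) \<Rightarrow> bool" where
  "generates j D L S \<longleftrightarrow>
     C0_semigroup S \<and> generator_graph S = (\<lambda>x. (blinfun_apply j x, L x)) ` D"

text \<open>\<open>z(t) = S(t) z\<^sub>0 + \<integral>\<^sub>0\<^sup>t S(t-s) f(s) ds\<close> for all \<open>t \<in> [0,T]\<close>, where the integral has to exist.\<close>

definition mild_solution ::
  "(real \<Rightarrow> 'h::real_normed_vector \<Rightarrow>\<^sub>L 'h) \<Rightarrow> real \<Rightarrow> (real \<Rightarrow> 'h) \<Rightarrow> 'h \<Rightarrow> (real \<Rightarrow> 'h) \<Rightarrow> bool" where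
  "mild_solution S T f z0 z \<longleftrightarrow>
     (\<forall>t\<in>{0..T}. ((\<lambda>s. blinfun_apply (S (t - s)) (f s))
                    has_integral (z t - blinfun_apply (S t) z0)) {0..t})"

section \<open>Function spaces\<close>

definition dense_embedding ::
  "('a::real_normed_vector \<Rightarrow>\<^sub>L 'b::real_normed_vector) \<Rightarrow> bool" where
  "dense_embedding j \<longleftrightarrow> inj (blinfun_apply j) \<and> closure (range (blinfun_apply j)) = UNIV"

text \<open>
  Elements of Lebesgue spaces are classes of functions. A space of such classes is a normed type
  together with a choice \<open>r\<close> of representatives, which is linear almost everywhere.
\<close>

definition L2_representation ::
  "real \<Rightarrow> ('x::real_normed_vector \<Rightarrow> real \<Rightarrow> 'b::real_normed_vector) \<Rightarrow> bool" where
  "L2_representation T r \<longleftrightarrow> (\<forall>x. in_L2 T (r x))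
     \<and> (\<forall>x x' a b. AE t in lebesgue_on {0..T}.
          r (a *\<^sub>R x + b *\<^sub>R x') t = a *\<^sub>R r x t + b *\<^sub>R r x' t)"

text \<open>The type \<open>'u\<close> is a copy of the whole of \<open>L\<^sup>2(0,T)\<close>.\<close>

definition is_L2_space :: "real \<Rightarrow> ('u::real_normed_vector \<Rightarrow> real \<Rightarrow> real) \<Rightarrow> bool" where
  "is_L2_space T r \<longleftrightarrow> L2_representation T r
     \<and> (\<forall>u. norm u = L2_norm T (r u))
     \<and> (\<forall>f. in_L2 T f \<longrightarrow> (\<exists>u. AE t in lebesgue_on {0..T}. r u t = f t))"

definition V_version ::
  "real \<Rightarrow> ('v::real_normed_vector \<Rightarrow>\<^sub>L 'h::real_normed_vector) \<Rightarrow> (real \<Rightarrow> 'h) \<Rightarrow> (real \<Rightarrow> 'v) \<Rightarrow> bool"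
where
  "V_version T j y f \<longleftrightarrow> in_L2 T f \<and> (AE t in lebesgue_on {0..T}. blinfun_apply j (f t) = y t)"

text \<open>
  The embedding of \<open>Y\<close> into \<open>L\<^sup>2(0,T;V) \<inter> C([0,T],H)\<close>: \<open>Y_H y\<close> is the continuous \<open>H\<close>-valued
  function given by \<open>y\<close> (values outside \<open>[0,T]\<close> are irrelevant). Boundary conditions
  are part of \<open>Y\<close>, that is, \<open>y(t) \<in> D\<close> for almost every \<open>t\<close>.
\<close>

definition Y_embedding ::
  "real \<Rightarrow> ('v::real_normed_vector \<Rightarrow>\<^sub>L 'h::real_normed_vector) \<Rightarrow> 'v set
     \<Rightarrow> ('y::real_normed_vector \<Rightarrow> real \<Rightarrow> 'h) \<Rightarrow> bool" where
  "Y_embedding T j D Y_H \<longleftrightarrow>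
     (\<forall>y. continuous_on {0..T} (Y_H y))
     \<and> (\<forall>y y' a b. \<forall>t\<in>{0..T}. Y_H (a *\<^sub>R y + b *\<^sub>R y') t = a *\<^sub>R Y_H y t + b *\<^sub>R Y_H y' t)
     \<and> (\<forall>y. (\<forall>t\<in>{0..T}. Y_H y t = 0) \<longrightarrow> y = 0)
     \<and> (\<exists>c. \<forall>y. \<forall>t\<in>{0..T}. norm (Y_H y t) \<le> c * norm y)
     \<and> (\<exists>c. \<forall>y. \<exists>f. V_version T j (Y_H y) f \<and> (AE t in lebesgue_on {0..T}. f t \<in> D)
                  \<and> L2_norm T f \<le> c * norm y)"

text \<open>The embedding of \<open>Z\<close> into \<open>L\<^sup>2(0,T;H) \<times> W\<close>, given by its two components.\<close>

definition Z_embedding ::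
  "real \<Rightarrow> ('z::real_normed_vector \<Rightarrow> real \<Rightarrow> 'h::real_normed_vector)
     \<Rightarrow> ('z \<Rightarrow>\<^sub>L 'w::real_normed_vector) \<Rightarrow> bool" where
  "Z_embedding T Z_H Z_W \<longleftrightarrow> L2_representation T Z_H
     \<and> (\<exists>c. \<forall>z. L2_norm T (Z_H z) \<le> c * norm z)
     \<and> (\<forall>z. (AE t in lebesgue_on {0..T}. Z_H z t = 0) \<and> blinfun_apply Z_W z = 0 \<longrightarrow> z = 0)"

definition const_in_Y ::
  "real \<Rightarrow> ('v::real_normed_vector \<Rightarrow>\<^sub>L 'h::real_normed_vector) \<Rightarrow> ('y \<Rightarrow> real \<Rightarrow> 'h)
     \<Rightarrow> 'y \<Rightarrow> 'v \<Rightarrow> bool" where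
  "const_in_Y T j Y_H y x \<longleftrightarrow> (\<forall>t\<in>{0..T}. Y_H y t = blinfun_apply j x)"

section \<open>The control problem\<close>

text \<open>
  \<open>jVW\<close>, \<open>jWH\<close> are the embeddings \<open>V \<rightarrow> W \<rightarrow> H\<close>. The operator \<open>A\<close>, as an unbounded operator in \<open>H\<close>,
  has the domain \<open>D \<subseteq> V\<close> (which carries the boundary conditions); boundedness or ellipticity of
  \<open>A\<close> and the order of \<open>N\<close> are not needed beyond the generation property. The operator \<open>E\<close> is
  described through the two components of \<open>Z \<subseteq> L\<^sup>2(0,T;H) \<times> W\<close>; \<open>A\<close> and \<open>N\<close> act pointwise in time
  on the \<open>V\<close>-valued version \<open>f\<close> of \<open>y\<close>.
\<close>

locale control_problem =
  fixes T :: real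
    and jVW :: "'v::{real_inner,banach} \<Rightarrow>\<^sub>L 'w::{real_inner,banach}"
    and jWH :: "'w \<Rightarrow>\<^sub>L 'h::{real_inner,banach}"
    and y0 :: 'w
    and F :: 'h
    and U_fun :: "'u::banach \<Rightarrow> real \<Rightarrow> real"
    and Y_H :: "'y::banach \<Rightarrow> real \<Rightarrow> 'h"
    and Z_H :: "'z::banach \<Rightarrow> real \<Rightarrow> 'h"
    and Z_W :: "'z \<Rightarrow>\<^sub>L 'w"
    and A :: "'v \<Rightarrow> 'h"
    and D :: "'v set"
    and N :: "'v \<Rightarrow> 'h"
    and E :: "'y \<times> 'u \<Rightarrow> 'z"
  assumes T_pos: "T > 0"
    and V_W: "dense_embedding jVW"
    and W_H: "dense_embedding jWH"
    and U_L2: "is_L2_space T U_fun"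
    and Y_emb: "Y_embedding T (jWH o\<^sub>L jVW) D Y_H"
    and Z_emb: "Z_embedding T Z_H Z_W"
    and A_linear: "linear A"
    and D_subspace: "subspace D"
    and E_equation: "\<forall>y u. \<exists>f g. V_version T (jWH o\<^sub>L jVW) (Y_H y) f \<and> has_time_derivative T (Y_H y) g
          \<and> (AE t in lebesgue_on {0..T}.
               Z_H (E (y, u)) t = g t - A (f t) + N (f t) - U_fun u t *\<^sub>R F)"
    and E_initial: "\<forall>y u. blinfun_apply jWH (blinfun_apply Z_W (E (y, u))) = Y_H y 0 - blinfun_apply jWH y0"
    and E_C1: "\<exists>E'. (\<forall>p. (E has_derivative blinfun_apply (E' p)) (at p)) \<and> continuous_on UNIV E'"
    and E_y_invertible: "\<forall>y u. \<exists>(P :: 'y \<Rightarrow>\<^sub>L 'z) (Q :: 'z \<Rightarrow>\<^sub>L 'y).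
          ((\<lambda>y'. E (y', u)) has_derivative blinfun_apply P) (at y)
          \<and> Q o\<^sub>L P = id_blinfun \<and> P o\<^sub>L Q = id_blinfun"
    and N_differentiable: "\<forall>y x. const_in_Y T (jWH o\<^sub>L jVW) Y_H y x \<longrightarrow> N differentiable (at x)"
    and generation: "\<forall>y x. const_in_Y T (jWH o\<^sub>L jVW) Y_H y x \<longrightarrow>
          (\<exists>S. generates (jWH o\<^sub>L jVW) D (\<lambda>z. A z - frechet_derivative N (at x) z) S)"

section \<open>The \<open>\<theta>\<close>-scheme\<close>

text \<open>
  \<open>(z\<^sub>k\<^sub>+\<^sub>1 - z\<^sub>k)/\<Delta>t - L(\<theta> z\<^sub>k\<^sub>+\<^sub>1 + (1-\<theta>) z\<^sub>k) = f\<^sub>k\<close> for \<open>k < K\<close>. The iterates live in \<open>H\<close>; the equation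
  requires the argument \<open>m\<close> of \<open>L\<close> to be in the domain \<open>D\<close>.
\<close>

definition theta_scheme ::
  "('v::real_normed_vector \<Rightarrow>\<^sub>L 'h::real_normed_vector) \<Rightarrow> 'v set \<Rightarrow> ('v \<Rightarrow> 'h)
     \<Rightarrow> real \<Rightarrow> real \<Rightarrow> nat \<Rightarrow> (nat \<Rightarrow> 'h) \<Rightarrow> (nat \<Rightarrow> 'h) \<Rightarrow> bool" where
  "theta_scheme j D L \<theta> dt K f z \<longleftrightarrow>
     (\<forall>k<K. \<exists>m\<in>D. blinfun_apply j m = \<theta> *\<^sub>R z (Suc k) + (1 - \<theta>) *\<^sub>R z k
                  \<and> (z (Suc k) - z k) /\<^sub>R dt - L m = f k)"

text \<open>
  \<open>(I + \<Delta>t(1-\<theta>)L) w\<^sub>0 = F\<close>, read as \<open>w\<^sub>0 + \<Delta>t L((1-\<theta>) w\<^sub>0) = F\<close>. For \<open>\<theta> = 1\<close> this is \<open>w\<^sub>0 = F\<close>,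
  without the requirement \<open>F \<in> D\<close>.
\<close>

definition theta_initial ::
  "('v::real_normed_vector \<Rightarrow>\<^sub>L 'h::real_normed_vector) \<Rightarrow> 'v set \<Rightarrow> ('v \<Rightarrow> 'h)
     \<Rightarrow> real \<Rightarrow> real \<Rightarrow> 'h \<Rightarrow> 'h \<Rightarrow> bool" where
  "theta_initial j D L \<theta> dt F w0 \<longleftrightarrow>
     (\<exists>m\<in>D. blinfun_apply j m = (1 - \<theta>) *\<^sub>R w0 \<and> w0 + dt *\<^sub>R L m = F)"

text \<open>
  A step of the scheme has at most one solution \<open>z\<^sub>k\<^sub>+\<^sub>1\<close>, i.e. \<open>I - \<Delta>t \<theta> L\<close> is injective on \<open>D\<close>.
  Generation of a semigroup by \<open>L\<close> gives this only for small \<open>\<Delta>t\<close>.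
\<close>

definition theta_unique ::
  "('v::real_normed_vector \<Rightarrow>\<^sub>L 'h::real_normed_vector) \<Rightarrow> 'v set \<Rightarrow> ('v \<Rightarrow> 'h)
     \<Rightarrow> real \<Rightarrow> real \<Rightarrow> bool" where
  "theta_unique j D L \<theta> dt \<longleftrightarrow> inj_on (\<lambda>x. blinfun_apply j x - (dt * \<theta>) *\<^sub>R L x) D"

end

theory Submission
  imports Defs
begin

text \<open>
  In both parts the difference of the two solutions solves the same linear equation with right
  hand side \<open>u F\<close> and initial value \<open>0\<close>, and is a superposition of time shifts of \<open>w\<close>.

  In continuous time the superposition is Duhamel's formula
  \<open>d(t) - v(t) = \<integral>\<^sub>0\<^sup>t u(s) w(t-s) ds\<close>, and the question is why the integral, which is only known to
  exist as a gauge integral in \<open>H\<close>, lies in a closed subspace of \<open>W\<close>. The integrand is a product of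
  two square integrable functions, hence Bochner integrable in \<open>W\<close>, and almost all its values lie in
  the span of the essential range. Let \<open>X\<close> be the Bochner integral of a function \<open>f\<close>. All that is
  used about it is Jensen's inequality \<open>q X \<le> \<integral> q (f s) ds\<close> for sublinear \<open>q\<close>
  (\<open>strongly_measurable_integral_exists\<close>):
  the distance to the span, as a choice of \<open>q\<close>, shows that \<open>X\<close> is in the closure of the span, and
  \<open>q a = \<plusminus> h \<bullet> j a\<close>, where \<open>j\<close> is the embedding into \<open>H\<close>, shows that \<open>j X\<close> is the gauge integral in
  \<open>H\<close>, because both have the same inner products with all \<open>h\<close> (\<open>gauge_integral_in_closure_span\<close>).

  For the \<open>\<theta>\<close>-scheme the superposition is \<open>d\<^sub>k - v\<^sub>k = \<Delta>t \<Sum>\<^sub>i\<^sub><\<^sub>k u\<^sub>i w\<^sub>k\<^sub>-\<^sub>i\<close> (\<open>theta_scheme_duhamel\<close>). The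
  modified initial value of \<open>w\<close> is the one for which \<open>\<Delta>t w\<^sub>1\<close> is the response, after one step from
  \<open>0\<close>, to the source \<open>F\<close>; in later steps the shifted sequences solve the homogeneous scheme. The
  sum therefore satisfies the scheme for \<open>d - v\<close>, whose steps have only one solution.
\<close>

section \<open>Sublinear functionals and Jensen's inequality for the Bochner integral\<close>

text \<open>
  Norms, bounded linear functionals and distances to subspaces have these properties in common.
  The bound by a multiple of the norm makes such a functional Lipschitz continuous.
\<close>

definition sublinear :: "('a::real_normed_vector \<Rightarrow> real) \<Rightarrow> bool" where
  "sublinear q \<longleftrightarrow>
     (\<forall>a b. q (a + b) \<le> q a + q b) \<and> (\<forall>c\<ge>0. \<forall>a. q (c *\<^sub>R a) = c * q a)
     \<and> (\<exists>B. \<forall>a. \<bar>q a\<bar> \<le> B * norm a)"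

lemma sublinear_bound:
  assumes "sublinear q"
  obtains B where "B \<ge> 0" "\<And>a. \<bar>q a\<bar> \<le> B * norm a" "\<And>a b. \<bar>q a - q b\<bar> \<le> B * norm (a - b)"
proof -
  obtain B0 where B0: "\<And>a. \<bar>q a\<bar> \<le> B0 * norm a"
    using assms unfolding sublinear_def by blast
  define B where "B = \<bar>B0\<bar>"
  have B: "\<bar>q a\<bar> \<le> B * norm a" for a
    unfolding B_def by (rule order_trans[OF B0 mult_right_mono]) auto
  have diff: "q a - q b \<le> B * norm (a - b)" for a b
  proof -
    have "q ((a - b) + b) \<le> q (a - b) + q b"
      using assms unfolding sublinear_def by blast
    then show ?thesis using B[of "a - b"] by auto
  qed
  have "\<bar>q a - q b\<bar> \<le> B * norm (a - b)" for a b
    using diff[of a b] diff[of b a] by (simp add: norm_minus_commute abs_le_iff)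
  then show thesis using that[of B] B B_def by auto
qed

lemma sublinear_zero: "sublinear q \<Longrightarrow> q 0 = 0"
  unfolding sublinear_def by (metis mult_zero_left order_refl scaleR_zero_left)

lemma sublinear_tendsto:
  assumes "sublinear q" "(f \<longlongrightarrow> a) G"
  shows "((\<lambda>i. q (f i)) \<longlongrightarrow> q a) G"
proof -
  obtain B where B: "\<And>a b. \<bar>q a - q b\<bar> \<le> B * norm (a - b)"
    by (rule sublinear_bound[OF assms(1)]) blast
  have "((\<lambda>i. B * norm (f i - a)) \<longlongrightarrow> B * norm (a - a)) G"
    by (intro tendsto_intros assms)
  then have "((\<lambda>i. B * norm (f i - a)) \<longlongrightarrow> 0) G" by simp
  then have "((\<lambda>i. q (f i) - q a) \<longlongrightarrow> 0) G"
    by (rule Lim_null_comparison[rotated]) (simp add: B)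
  then show ?thesis by (simp add: LIM_zero_cancel)
qed

lemma sublinear_sum:
  assumes q: "sublinear q" and "finite I" "\<And>i. i \<in> I \<Longrightarrow> c i \<ge> 0"
  shows "q (\<Sum>i\<in>I. c i *\<^sub>R a i) \<le> (\<Sum>i\<in>I. c i * q (a i))"
  using assms(2,3)
proof (induction I rule: finite_induct)
  case empty
  then show ?case by (simp add: sublinear_zero[OF q])
next
  case (insert j I)
  have "q (c j *\<^sub>R a j + (\<Sum>i\<in>I. c i *\<^sub>R a i)) \<le> q (c j *\<^sub>R a j) + q (\<Sum>i\<in>I. c i *\<^sub>R a i)"
    using q unfolding sublinear_def by blast
  moreover have "q (c j *\<^sub>R a j) = c j * q (a j)"
    using q insert.prems[of j] unfolding sublinear_def by blast
  moreover have "q (\<Sum>i\<in>I. c i *\<^sub>R a i) \<le> (\<Sum>i\<in>I. c i * q (a i))"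
    using insert.IH insert.prems by blast
  ultimately show ?case using insert.hyps by simp
qed

lemma sublinear_norm: "sublinear norm"
  unfolding sublinear_def by (auto intro: norm_triangle_ineq exI[of _ 1])

lemma sublinear_bounded_linear:
  assumes "bounded_linear l"
  shows "sublinear l"
proof -
  interpret bounded_linear l by fact
  obtain K where "\<And>x. norm (l x) \<le> norm x * K" using bounded by blast
  then show ?thesis unfolding sublinear_def
    by (auto simp: add scaleR mult.commute intro!: exI[of _ K])
qed

lemma sublinear_infdist_subspace:
  assumes M: "subspace M"
  shows "sublinear (\<lambda>x. infdist x M)"
proof -
  have ne: "M \<noteq> {}" using subspace_0[OF M] by blast
  have scale: "infdist (c *\<^sub>R x) M \<le> c * infdist x M" if c: "c > 0" for c x
  proof -
    have "infdist (c *\<^sub>R x) M / c \<le> infdist x M"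
      unfolding infdist_notempty[OF ne, of x]
    proof (rule cINF_greatest[OF ne])
      fix m assume "m \<in> M"
      then have "infdist (c *\<^sub>R x) M \<le> dist (c *\<^sub>R x) (c *\<^sub>R m)"
        by (intro infdist_le subspace_scale[OF M])
      also have "\<dots> = c * dist x m" using c by (simp add: dist_norm flip: scaleR_diff_right)
      finally show "infdist (c *\<^sub>R x) M / c \<le> dist x m" using c by (simp add: field_simps)
    qed
    then show ?thesis using c by (simp add: field_simps)
  qed
  have "infdist (c *\<^sub>R x) M = c * infdist x M" if "c \<ge> 0" for c x
  proof (cases "c = 0")
    case True
    then show ?thesis using subspace_0[OF M] by simp
  next
    case False
    with that have c: "c > 0" by simp
    have "infdist (inverse c *\<^sub>R (c *\<^sub>R x)) M \<le> inverse c * infdist (c *\<^sub>R x) M"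
      by (rule scale) (use c in simp)
    then have "c * infdist x M \<le> infdist (c *\<^sub>R x) M" using c by (simp add: field_simps)
    with scale[OF c] show ?thesis by (rule order_antisym)
  qed
  moreover have "infdist (x + y) M \<le> infdist x M + infdist y M" for x y
  proof -
    have 1: "infdist (x + y) M - dist x m \<le> infdist y M" if m: "m \<in> M" for m
      unfolding infdist_notempty[OF ne, of y]
    proof (rule cINF_greatest[OF ne])
      fix n assume "n \<in> M"
      then have "infdist (x + y) M \<le> dist (x + y) (m + n)"
        by (intro infdist_le subspace_add[OF M] m)
      also have "\<dots> \<le> dist x m + dist y n" by (rule dist_triangle_add)
      finally show "infdist (x + y) M - dist x m \<le> dist y n" by simp
    qed
    have "infdist (x + y) M - infdist y M \<le> infdist x M"
      unfolding infdist_notempty[OF ne, of x]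
      by (rule cINF_greatest[OF ne]) (use 1 in fastforce)
    then show ?thesis by simp
  qed
  moreover have "\<bar>infdist x M\<bar> \<le> 1 * norm x" for x
    using infdist_le[OF subspace_0[OF M], of x] by (simp add: infdist_nonneg)
  ultimately show ?thesis unfolding sublinear_def by blast
qed

text \<open>
  A simple integral is a finite sum of values with nonnegative coefficients, so subadditivity and
  homogeneity suffice.
\<close>

lemma sublinear_simple_bochner_integral_le:
  assumes q: "sublinear q" and s: "Bochner_Integration.simple_bochner_integrable M s"
  shows "q (Bochner_Integration.simple_bochner_integral M s) \<le> (LINT x|M. q (s x))"
proof -
  have fin: "finite (s ` space M)"
    using s by (auto elim!: simple_bochner_integrable.cases simp: simple_function_def)
  have qs: "Bochner_Integration.simple_bochner_integrable M (\<lambda>x. q (s x))"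
    using simple_bochner_integrable_compose2[OF _ s s, of "\<lambda>a b. q a"] sublinear_zero[OF q] by simp
  have "q (Bochner_Integration.simple_bochner_integral M s) \<le> (\<Sum>y\<in>s ` space M. measure M {x\<in>space M. s x = y} * q y)"
    unfolding simple_bochner_integral_def by (rule sublinear_sum[OF q fin]) simp
  also have "\<dots> = Bochner_Integration.simple_bochner_integral M (\<lambda>x. q (s x))"
    using simple_bochner_integral_partition[OF qs, of s q] s
    by (auto elim: simple_bochner_integrable.cases)
  also have "\<dots> = (LINT x|M. q (s x))" by (rule simple_bochner_integrable_eq_integral[OF qs])
  finally show ?thesis .
qed

text \<open>
  The vector \<open>X\<close> is the Bochner integral of \<open>f\<close>, constructed in a space that need not be
  separable. It is the limit of the integrals of simple functions, and Jensen's inequality passes to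
  the limit by dominated convergence. The function \<open>f'\<close> replaces \<open>f\<close> by \<open>0\<close> on a null set off which
  the simple functions converge; then \<open>q (f' x)\<close> is an everywhere limit of measurable functions,
  and thus measurable on a measure space that need not be complete.
\<close>

lemma strongly_measurable_integral_exists:
  fixes f :: "'a \<Rightarrow> 'b::banach"
  assumes f: "strongly_measurable M f" and int: "integrable M (\<lambda>x. norm (f x))"
  shows "\<exists>f' X. (AE x in M. f' x = f x)
    \<and> (\<forall>q. sublinear q \<longrightarrow> integrable M (\<lambda>x. q (f' x)) \<and> q X \<le> (LINT x|M. q (f' x)))"
proof -
  obtain s where s: "\<And>i. simple_function M (s i)" and lim: "AE x in M. (\<lambda>i. s i x) \<longlonglongrightarrow> f x"
    using f unfolding strongly_measurable_def by blast
  obtain E where E: "\<And>x. x \<in> space M - E \<Longrightarrow> (\<lambda>i. s i x) \<longlonglongrightarrow> f x"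
      and E0: "E \<in> null_sets M"
    using lim by (rule AE_E3) blast
  define f' where "f' x = (if x \<in> E then 0 else f x)" for x
  \<comment> \<open>Truncation at twice the norm of the limit gives an integrable majorant and still keeps
    \<open>s i x\<close> for large \<open>i\<close> wherever \<open>f x \<noteq> 0\<close>.\<close>
  define A where "A i = {x \<in> space M. norm (s i x) \<le> 2 * norm (f x)} - E" for i
  define r where "r i x = (if x \<in> A i then s i x else 0)" for i x
  have [measurable]: "(\<lambda>x. norm (f x)) \<in> borel_measurable M" using int by simp
  have [measurable]: "s i \<in> borel_measurable M" for i
    using s by (rule borel_measurable_simple_function)
  have [measurable]: "E \<in> sets M" using E0 by blast
  have A: "A i \<in> sets M" for i unfolding A_def by measurable
  have rs: "simple_function M (r i)" for i
    unfolding r_def using A by (intro simple_function_If_set s simple_function_const) auto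
  have rb: "norm (r i x) \<le> 2 * norm (f x)" for i x unfolding r_def A_def by auto
  have int2: "integrable M (\<lambda>x. 2 * norm (f x))" using int by simp
  have ri: "Bochner_Integration.simple_bochner_integrable M (r i)" for i
  proof (rule simple_bochner_integrableI_bounded[OF rs])
    have "(\<integral>\<^sup>+x. ennreal (norm (r i x)) \<partial>M) \<le> (\<integral>\<^sup>+x. ennreal (2 * norm (f x)) \<partial>M)"
      by (intro nn_integral_mono ennreal_leI rb)
    also have "\<dots> < \<infinity>" using int2 unfolding integrable_iff_bounded by simp
    finally show "(\<integral>\<^sup>+x. ennreal (norm (r i x)) \<partial>M) < \<infinity>" .
  qed
  have rlim: "(\<lambda>i. r i x) \<longlonglongrightarrow> f' x" if x: "x \<in> space M" for x
  proof (cases "x \<in> E \<or> f x = 0")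
    case True
    then have "r i x = 0" "f' x = 0" for i
      using rb[of i x] unfolding r_def A_def f'_def by auto
    then show ?thesis by simp
  next
    case False
    then have "(\<lambda>i. norm (s i x)) \<longlonglongrightarrow> norm (f x)" using E[of x] x by (auto intro: tendsto_norm)
    then have "\<forall>\<^sub>F i in sequentially. norm (s i x) < 2 * norm (f x)"
      by (rule order_tendstoD) (use False in simp)
    then have "\<forall>\<^sub>F i in sequentially. s i x = r i x"
      by eventually_elim (use x False in \<open>auto simp: r_def A_def\<close>)
    moreover have "(\<lambda>i. s i x) \<longlonglongrightarrow> f' x" using E[of x] x False by (auto simp: f'_def)
    ultimately show ?thesis by (rule Lim_transform_eventually[rotated])
  qed
  have qint: "integrable M (\<lambda>x. q (f' x))"
    and qlim: "(\<lambda>i. LINT x|M. q (r i x)) \<longlonglongrightarrow> (LINT x|M. q (f' x))" if q: "sublinear q" for q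
  proof -
    obtain B where B: "B \<ge> 0" "\<And>a. \<bar>q a\<bar> \<le> B * norm a"
      by (rule sublinear_bound[OF q]) blast
    have qr: "(\<lambda>x. q (r i x)) \<in> borel_measurable M" for i
      by (rule borel_measurable_simple_function[OF simple_function_compose1[OF rs]])
    have ql: "(\<lambda>i. q (r i x)) \<longlonglongrightarrow> q (f' x)" if "x \<in> space M" for x
      by (rule sublinear_tendsto[OF q rlim[OF that]])
    have qf: "(\<lambda>x. q (f' x)) \<in> borel_measurable M"
      by (rule borel_measurable_LIMSEQ_real[OF ql qr])
    have w: "integrable M (\<lambda>x. B * (2 * norm (f x)))" using int2 by simp
    have bd: "AE x in M. norm (q (r i x)) \<le> B * (2 * norm (f x))" for i
      unfolding real_norm_def
      by (intro AE_I2 order_trans[OF B(2) mult_left_mono[OF rb B(1)]])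
    have qAE: "AE x in M. (\<lambda>i. q (r i x)) \<longlonglongrightarrow> q (f' x)"
      by (intro AE_I2 ql)
    show "integrable M (\<lambda>x. q (f' x))"
      by (rule integrable_dominated_convergence[where s = "\<lambda>i x. q (r i x)", OF qf qr w qAE bd])
    show "(\<lambda>i. LINT x|M. q (r i x)) \<longlonglongrightarrow> (LINT x|M. q (f' x))"
      by (rule integral_dominated_convergence[where s = "\<lambda>i x. q (r i x)", OF qf qr w qAE bd])
  qed
  define J where "J i = Bochner_Integration.simple_bochner_integral M (r i)" for i
  have nr: "(\<lambda>x. norm (r i x - r k x)) \<in> borel_measurable M" for i k
    by (rule borel_measurable_simple_function[OF simple_function_compose2[OF rs rs]])
  have nlim: "(\<lambda>k. norm (r i x - r k x)) \<longlonglongrightarrow> norm (r i x - f' x)" if "x \<in> space M" for i x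
    by (intro tendsto_intros rlim that)
  have nf: "(\<lambda>x. norm (r i x - f' x)) \<in> borel_measurable M" for i
    by (rule borel_measurable_LIMSEQ_real[OF nlim nr])
  have w: "integrable M (\<lambda>x. 3 * norm (f x))" using int by simp
  have nb: "AE x in M. norm (norm (r i x - f' x)) \<le> 3 * norm (f x)" for i
  proof (rule AE_I2)
    fix x
    have "norm (f' x) \<le> norm (f x)" unfolding f'_def by simp
    then show "norm (norm (r i x - f' x)) \<le> 3 * norm (f x)"
      using norm_triangle_ineq4[of "r i x" "f' x"] rb[of i x] by simp
  qed
  have nint: "integrable M (\<lambda>x. norm (r i x - f' x))" for i
    by (rule Bochner_Integration.integrable_bound[OF w nf]) (use nb[of i] in auto)
  have n0: "AE x in M. (\<lambda>i. norm (r i x - f' x)) \<longlonglongrightarrow> 0"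
    by (intro AE_I2 tendsto_norm_zero LIM_zero rlim)
  have "(\<lambda>i. LINT x|M. norm (r i x - f' x)) \<longlonglongrightarrow> (LINT x|M. 0)"
    by (rule integral_dominated_convergence[where s = "\<lambda>i x. norm (r i x - f' x)",
          OF borel_measurable_const nf w n0 nb])
  then have L1: "(\<lambda>i. LINT x|M. norm (r i x - f' x)) \<longlonglongrightarrow> 0" by simp
  have Jdiff: "norm (J i - J k) \<le> (LINT x|M. norm (r i x - f' x)) + (LINT x|M. norm (r k x - f' x))"
    for i k
  proof -
    have sb: "Bochner_Integration.simple_bochner_integrable M (\<lambda>x. r i x - r k x)"
      by (rule simple_bochner_integrable_compose2[OF _ ri ri]) simp
    have "J i - J k = Bochner_Integration.simple_bochner_integral M (\<lambda>x. r i x - r k x)"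
      unfolding J_def by (rule simple_bochner_integral_diff[OF ri ri, symmetric])
    then have "norm (J i - J k) \<le> (LINT x|M. norm (r i x - r k x))"
      using sublinear_simple_bochner_integral_le[OF sublinear_norm sb] by simp
    also have "\<dots> \<le> (LINT x|M. norm (r i x - f' x) + norm (r k x - f' x))"
    proof (rule integral_mono)
      show "norm (r i x - r k x) \<le> norm (r i x - f' x) + norm (r k x - f' x)" for x
        by (metis dist_norm dist_triangle2)
      show "integrable M (\<lambda>x. norm (r i x - f' x) + norm (r k x - f' x))"
        using nint by simp
      then show "integrable M (\<lambda>x. norm (r i x - r k x))"
        by (rule Bochner_Integration.integrable_bound[OF _ nr])
           (auto intro!: AE_I2 simp: dist_norm[symmetric] dist_triangle2)
    qed
    also have "\<dots> = (LINT x|M. norm (r i x - f' x)) + (LINT x|M. norm (r k x - f' x))"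
      using nint by simp
    finally show ?thesis .
  qed
  have "Cauchy J"
  proof (rule metric_CauchyI)
    fix e :: real assume "e > 0"
    then obtain n where n: "\<And>i. i \<ge> n \<Longrightarrow> \<bar>LINT x|M. norm (r i x - f' x)\<bar> < e / 2"
      using LIMSEQ_D[OF L1, of "e / 2"] by auto
    show "\<exists>n. \<forall>i\<ge>n. \<forall>k\<ge>n. dist (J i) (J k) < e"
    proof (intro exI allI impI)
      fix i k assume "n \<le> i" "n \<le> k"
      then show "dist (J i) (J k) < e"
        using n[of i] n[of k] Jdiff[of i k] by (simp add: dist_norm)
    qed
  qed
  then obtain X where X: "J \<longlonglongrightarrow> X" by (auto simp: convergent_eq_Cauchy[symmetric])
  show ?thesis
  proof (intro exI conjI allI impI)
    show "AE x in M. f' x = f x"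
      using AE_not_in[OF E0] by eventually_elim (simp add: f'_def)
    show "integrable M (\<lambda>x. q (f' x))" if "sublinear q" for q by (rule qint[OF that])
    show "q X \<le> (LINT x|M. q (f' x))" if q: "sublinear q" for q
      by (rule LIMSEQ_le[OF sublinear_tendsto[OF q X] qlim[OF q]])
         (use sublinear_simple_bochner_integral_le[OF q ri] in \<open>auto simp: J_def\<close>)
  qed
qed

section \<open>Essential range\<close>

text \<open>
  The essential range is an uncountable intersection, but countably many null sets suffice:
  almost all values of \<open>f\<close> are limits of points of a countable set \<open>Q\<close>, and one null set is needed
  only for each ball of radius \<open>1/(n+1)\<close> around a point of \<open>Q\<close> that \<open>f\<close> avoids almost everywhere.
\<close>

lemma AE_strongly_measurable_in_essential_range:
  fixes f :: "real \<Rightarrow> 'b::real_normed_vector"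
  assumes "strongly_measurable (lebesgue_on {0..T}) f"
  shows "AE t in lebesgue_on {0..T}. f t \<in> essential_range T f"
proof -
  obtain s where s: "\<And>i. simple_function (lebesgue_on {0..T}) (s i)"
    and lim: "AE t in lebesgue_on {0..T}. (\<lambda>i. s i t) \<longlonglongrightarrow> f t"
    using assms unfolding strongly_measurable_def by blast
  define Q where "Q = (\<Union>i. s i ` {0..T})"
  have Q: "countable Q"
    unfolding Q_def using s by (auto simp: simple_function_def intro: countable_finite)
  define P where "P q n N \<longleftrightarrow> N \<subseteq> {0..T} \<and> N \<in> null_sets lebesgue
      \<and> ball q (inverse (real (Suc n))) \<inter> f ` ({0..T} - N) = {}" for q n N
  define N where "N q n = (if \<exists>N. P q n N then SOME N. P q n N else {})" for q n
  have N: "P q n (N q n)" if "P q n N'" for q n N'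
    unfolding N_def using that by (metis someI_ex)
  have N0: "N q n \<in> null_sets lebesgue" for q n
  proof (cases "\<exists>N'. P q n N'")
    case True
    then have "P q n (N q n)" using N by blast
    then show ?thesis unfolding P_def by blast
  qed (simp add: N_def)
  have "(\<Union>q\<in>Q. \<Union>n. N q n) \<in> null_sets lebesgue"
    by (intro null_sets_UN' Q null_sets_UN N0)
  then have "AE t in lebesgue. t \<notin> (\<Union>q\<in>Q. \<Union>n. N q n)" by (rule AE_not_in)
  moreover have "AE t in lebesgue. t \<in> {0..T} \<longrightarrow> (\<lambda>i. s i t) \<longlonglongrightarrow> f t"
    using lim by (simp add: AE_restrict_space_iff)
  ultimately have "AE t in lebesgue. t \<in> {0..T} \<longrightarrow> f t \<in> essential_range T f"
  proof eventually_elim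
    case (elim t)
    show ?case
    proof (rule impI, rule ccontr)
      assume t: "t \<in> {0..T}" and "f t \<notin> essential_range T f"
      then obtain N' where N': "N' \<subseteq> {0..T}" "N' \<in> null_sets lebesgue"
        and "f t \<notin> closure (f ` ({0..T} - N'))"
        unfolding essential_range_def by blast
      then obtain r where r: "r > 0" "\<And>x. x \<in> f ` ({0..T} - N') \<Longrightarrow> \<not> dist x (f t) < r"
        unfolding closure_approachable by blast
      obtain n where n: "inverse (real (Suc n)) < r / 2"
        using reals_Archimedean[of "r / 2"] r by auto
      obtain i where i: "dist (s i t) (f t) < inverse (real (Suc n))"
        using elim(2) t metric_LIMSEQ_D[of "\<lambda>i. s i t" "f t" "inverse (real (Suc n))"] by auto
      have "ball (s i t) (inverse (real (Suc n))) \<inter> f ` ({0..T} - N') = {}"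
      proof (rule ccontr)
        assume "\<not> ?thesis"
        then obtain x where x: "x \<in> f ` ({0..T} - N')" "dist (s i t) x < inverse (real (Suc n))"
          by (auto simp: ball_def)
        have "dist x (f t) \<le> dist (s i t) x + dist (s i t) (f t)"
          by (metis dist_triangle3)
        with x i n r(2)[of x] show False by linarith
      qed
      then have "P (s i t) n (N (s i t) n)" using N N' unfolding P_def by blast
      moreover have "t \<notin> N (s i t) n" using elim(1) t unfolding Q_def by blast
      ultimately show False using t i unfolding P_def by auto
    qed
  qed
  then show ?thesis by (simp add: AE_restrict_space_iff)
qed

section \<open>Square integrable functions under time reversal, and their products\<close>

lemma distr_lebesgue_reflect: "distr lebesgue lebesgue (\<lambda>s. t - s) = (lebesgue :: real measure)"
  using lebesgue_real_affine[of "-1" t] by (simp add: density_1)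

lemma measurable_lebesgue_reflect: "(\<lambda>s. t - s) \<in> lebesgue \<rightarrow>\<^sub>M (lebesgue :: real measure)"
  using lebesgue_affine_measurable[of "\<lambda>_::real. -1" t] by simp

lemma AE_lebesgue_on_reflect:
  fixes T t :: real
  assumes "AE s in lebesgue_on {0..T}. P s" "t \<le> T"
  shows "AE s in lebesgue_on {0..t}. P (t - s)"
proof -
  have "AE s in distr lebesgue lebesgue (\<lambda>s. t - s). s \<in> {0..T} \<longrightarrow> P s"
    using assms(1) unfolding distr_lebesgue_reflect by (simp add: AE_restrict_space_iff)
  from AE_distrD[OF measurable_lebesgue_reflect this]
  have "AE s in lebesgue. t - s \<in> {0..T} \<longrightarrow> P (t - s)" .
  then have "AE s in lebesgue. s \<in> {0..t} \<longrightarrow> P (t - s)"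
    by eventually_elim (use assms(2) in auto)
  then show ?thesis by (simp add: AE_restrict_space_iff)
qed

lemma in_L2_reflect:
  assumes f: "in_L2 T f" and t: "t \<le> T"
  shows "in_L2 t (\<lambda>s. f (t - s))"
proof -
  obtain r where r: "\<And>i. simple_function (lebesgue_on {0..T}) (r i)"
    and lim: "AE t in lebesgue_on {0..T}. (\<lambda>i. r i t) \<longlonglongrightarrow> f t"
    using f unfolding in_L2_def strongly_measurable_def by blast
  have "(\<lambda>s. t - s) \<in> lebesgue_on {0..t} \<rightarrow>\<^sub>M lebesgue_on {0..T}"
    by (rule measurable_restrict_space3[OF measurable_lebesgue_reflect]) (use t in auto)
  then have "simple_function (lebesgue_on {0..t}) (\<lambda>s. r i (t - s))" for i
    by (rule simple_function_comp[OF _ r])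
  moreover have "AE s in lebesgue_on {0..t}. (\<lambda>i. r i (t - s)) \<longlonglongrightarrow> f (t - s)"
    by (rule AE_lebesgue_on_reflect[OF lim t])
  moreover have "integrable (lebesgue_on {0..t}) (\<lambda>s. (norm (f (t - s)))\<^sup>2)"
  proof -
    have "integrable (lebesgue_on {0..t}) (\<lambda>s. (norm (f s))\<^sup>2)"
      by (rule integrable_subinterval[of 0 T]) (use f t in \<open>auto simp: in_L2_def\<close>)
    then have "integrable (distr lebesgue lebesgue (\<lambda>s. t - s))
        (\<lambda>s. indicator {0..t} s *\<^sub>R (norm (f s))\<^sup>2)"
      unfolding distr_lebesgue_reflect by (simp add: integrable_restrict_space)
    from integrable_distr[OF measurable_lebesgue_reflect this]
    have "integrable lebesgue (\<lambda>s. indicator {0..t} (t - s) *\<^sub>R (norm (f (t - s)))\<^sup>2)" .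
    also have "(\<lambda>s. indicator {0..t} (t - s) *\<^sub>R (norm (f (t - s)))\<^sup>2)
        = (\<lambda>s. indicat_real {0..t} s *\<^sub>R (norm (f (t - s)))\<^sup>2)"
      by (auto simp: indicator_def)
    finally show ?thesis by (simp add: integrable_restrict_space)
  qed
  ultimately show ?thesis
    unfolding in_L2_def strongly_measurable_def
    by (intro conjI exI[of _ "\<lambda>i s. r i (t - s)"] allI)
qed

text \<open>Reversing time twice on \<open>[0,t]\<close> gives back \<open>f\<close>.\<close>

lemma in_L2_subinterval:
  assumes "in_L2 T f" "t \<le> T"
  shows "in_L2 t f"
  using in_L2_reflect[OF in_L2_reflect[OF assms] order_refl] by simp

lemma in_L2_scaleR_integrable:
  fixes f :: "real \<Rightarrow> 'b::real_normed_vector"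
  assumes u: "in_L2 T u" and f: "in_L2 T f"
  shows "strongly_measurable (lebesgue_on {0..T}) (\<lambda>s. u s *\<^sub>R f s)"
    and "integrable (lebesgue_on {0..T}) (\<lambda>s. norm (u s *\<^sub>R f s))"
proof -
  let ?M = "lebesgue_on {0..T}"
  obtain r where r: "\<And>i. simple_function ?M (r i)" "AE t in ?M. (\<lambda>i. r i t) \<longlonglongrightarrow> u t"
    using u unfolding in_L2_def strongly_measurable_def by blast
  obtain s where s: "\<And>i. simple_function ?M (s i)" "AE t in ?M. (\<lambda>i. s i t) \<longlonglongrightarrow> f t"
    using f unfolding in_L2_def strongly_measurable_def by blast
  have "AE t in ?M. (\<lambda>i. r i t *\<^sub>R s i t) \<longlonglongrightarrow> u t *\<^sub>R f t"
    using r(2) s(2) by eventually_elim (rule tendsto_scaleR)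
  then show "strongly_measurable ?M (\<lambda>s. u s *\<^sub>R f s)"
    unfolding strongly_measurable_def
    by (intro exI[of _ "\<lambda>i t. r i t *\<^sub>R s i t"] conjI allI simple_function_compose2[OF r(1) s(1)])
  have meas: "(\<lambda>t. norm (g t)) \<in> borel_measurable ?M" if "in_L2 T g" for g :: "real \<Rightarrow> 'c::real_normed_vector"
  proof -
    have "(\<lambda>t. (norm (g t))\<^sup>2) \<in> borel_measurable ?M"
      using that unfolding in_L2_def by auto
    then have "(\<lambda>t. sqrt ((norm (g t))\<^sup>2)) \<in> borel_measurable ?M" by measurable
    then show ?thesis by simp
  qed
  show "integrable ?M (\<lambda>s. norm (u s *\<^sub>R f s))"
  proof (rule Bochner_Integration.integrable_bound)
    show "integrable ?M (\<lambda>t. (norm (u t))\<^sup>2 + (norm (f t))\<^sup>2)"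
      using u f unfolding in_L2_def by (intro Bochner_Integration.integrable_add) auto
    show "(\<lambda>s. norm (u s *\<^sub>R f s)) \<in> borel_measurable ?M"
      using borel_measurable_times[OF meas[OF u] meas[OF f]] by simp
    have "a * b \<le> a\<^sup>2 + b\<^sup>2" if "a \<ge> 0" "b \<ge> 0" for a b :: real
      using sum_squares_bound[of a b] mult_nonneg_nonneg[OF that] by linarith
    from this[OF abs_ge_zero norm_ge_zero]
    show "AE s in ?M. norm (norm (u s *\<^sub>R f s)) \<le> norm ((norm (u s))\<^sup>2 + (norm (f s))\<^sup>2)"
      by (intro AE_I2) (force simp: abs_mult)
  qed
qed

section \<open>Integrals with values in the closure of a span\<close>

text \<open>
  No gauge integral is formed in \<open>'w\<close>: the Bochner integral \<open>X\<close> of \<open>f\<close> is compared with the gauge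
  integral \<open>x\<close> of \<open>j f\<close> by real integrals only, for which the two notions are known to agree.
\<close>

lemma gauge_integral_in_closure_span:
  fixes j :: "'w::banach \<Rightarrow>\<^sub>L 'h::{real_inner,banach}"
  assumes S: "S \<in> sets lebesgue"
    and f: "strongly_measurable (lebesgue_on S) f" "integrable (lebesgue_on S) (\<lambda>s. norm (f s))"
    and g: "(g has_integral x) (S :: real set)"
    and fg: "AE s in lebesgue_on S. j (f s) = g s"
    and E: "AE s in lebesgue_on S. f s \<in> span E"
  shows "x \<in> j ` closure (span E)"
proof -
  obtain f' X where ff: "AE s in lebesgue_on S. f' s = f s"
    and int: "\<And>q. sublinear q \<Longrightarrow> integrable (lebesgue_on S) (\<lambda>s. q (f' s))"
    and le: "\<And>q. sublinear q \<Longrightarrow> q X \<le> (LINT s|lebesgue_on S. q (f' s))"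
    using strongly_measurable_integral_exists[OF f] by blast
  have "infdist X (span E) \<le> (LINT s|lebesgue_on S. infdist (f' s) (span E))"
    by (rule le[OF sublinear_infdist_subspace[OF subspace_span]])
  also have "\<dots> = 0"
  proof (rule integral_eq_zero_AE)
    show "AE s in lebesgue_on S. infdist (f' s) (span E) = 0"
      using ff E by eventually_elim simp
  qed
  finally have "infdist X (span E) = 0" by (simp add: infdist_nonneg order_antisym)
  then have X: "X \<in> closure (span E)"
    using in_closure_iff_infdist_zero[of "span E" X] span_zero[of E] by blast
  have "h \<bullet> x = h \<bullet> j X" for h
  proof -
    define l where "l a = h \<bullet> j a" for a
    have l: "bounded_linear l"
      unfolding l_def by (rule bounded_linear_compose[OF bounded_linear_inner_right blinfun.bounded_linear_right])
    have ml: "bounded_linear (\<lambda>a. - l a)" by (rule bounded_linear_minus[OF l])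
    \<comment> \<open>Jensen's inequality for \<open>l\<close> and for \<open>- l\<close> gives an equation.\<close>
    have "l X = (LINT s|lebesgue_on S. l (f' s))"
      using le[OF sublinear_bounded_linear[OF l]] le[OF sublinear_bounded_linear[OF ml]] by simp
    then have 1: "((\<lambda>s. l (f' s)) has_integral l X) S"
      using has_integral_integral_lebesgue_on[OF int[OF sublinear_bounded_linear[OF l]] S] by simp
    have "AE s in lebesgue_on S. l (f' s) = h \<bullet> g s"
      using ff fg by eventually_elim (simp add: l_def)
    then have "AE s in lebesgue. s \<in> S \<longrightarrow> l (f' s) = h \<bullet> g s"
      using S by (simp add: AE_restrict_space_iff)
    then obtain Z where Z: "negligible Z" "{s. \<not> (s \<in> S \<longrightarrow> l (f' s) = h \<bullet> g s)} \<subseteq> Z"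
      unfolding eventually_ae_filter_negligible by blast
    have "((\<lambda>s. h \<bullet> g s) has_integral l X) S"
      by (rule has_integral_spike[OF Z(1) _ 1]) (use Z(2) in auto)
    moreover have "((\<lambda>s. h \<bullet> g s) has_integral h \<bullet> x) S"
      using has_integral_linear[OF g bounded_linear_inner_right] by (simp add: o_def)
    ultimately show ?thesis unfolding l_def by (simp add: has_integral_unique)
  qed
  from this[of "x - j X"] have "(x - j X) \<bullet> (x - j X) = 0" by (simp add: inner_diff_right)
  then have "x = j X" by simp
  with X show ?thesis by blast
qed

section \<open>Superposition for the theta scheme\<close>

lemma theta_scheme_diff:
  assumes L: "linear L" and D: "subspace D"
    and a: "theta_scheme j D L \<theta> dt K f a" and b: "theta_scheme j D L \<theta> dt K g b"
  shows "theta_scheme j D L \<theta> dt K (\<lambda>k. f k - g k) (\<lambda>k. a k - b k)"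
  unfolding theta_scheme_def
proof (intro allI impI)
  fix k assume k: "k < K"
  obtain m where m: "m \<in> D" "j m = \<theta> *\<^sub>R a (Suc k) + (1 - \<theta>) *\<^sub>R a k"
      "(a (Suc k) - a k) /\<^sub>R dt - L m = f k"
    using a k unfolding theta_scheme_def by blast
  obtain n where n: "n \<in> D" "j n = \<theta> *\<^sub>R b (Suc k) + (1 - \<theta>) *\<^sub>R b k"
      "(b (Suc k) - b k) /\<^sub>R dt - L n = g k"
    using b k unfolding theta_scheme_def by blast
  show "\<exists>p\<in>D. j p = \<theta> *\<^sub>R (a (Suc k) - b (Suc k)) + (1 - \<theta>) *\<^sub>R (a k - b k)
      \<and> (a (Suc k) - b (Suc k) - (a k - b k)) /\<^sub>R dt - L p = f k - g k"
    using subspace_diff[OF D m(1) n(1)]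
    by (intro bexI[of _ "m - n"] conjI)
       (simp_all add: blinfun.diff_right linear_diff[OF L] m(2) n(2) m(3)[symmetric] n(3)[symmetric]
         algebra_simps)
qed

text \<open>
  Uniqueness is known for the argument \<open>m\<close> of \<open>L\<close>: eliminating \<open>z\<close> from the step gives
  \<open>j m - \<Delta>t \<theta> L m = y + \<Delta>t \<theta> f\<close>. Then \<open>j m\<close> determines \<open>z\<close>.
\<close>

lemma theta_step_unique:
  assumes inj: "theta_unique j D L \<theta> dt" and \<theta>: "\<theta> \<noteq> 0" and dt: "dt \<noteq> 0"
    and m: "m \<in> D" "j m = \<theta> *\<^sub>R z + (1 - \<theta>) *\<^sub>R y" "(z - y) /\<^sub>R dt - L m = f"
    and m': "m' \<in> D" "j m' = \<theta> *\<^sub>R z' + (1 - \<theta>) *\<^sub>R y" "(z' - y) /\<^sub>R dt - L m' = f"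
  shows "z = z'"
proof -
  have step: "j n - (dt * \<theta>) *\<^sub>R L n = y + (dt * \<theta>) *\<^sub>R f"
    if "j n = \<theta> *\<^sub>R x + (1 - \<theta>) *\<^sub>R y" "(x - y) /\<^sub>R dt - L n = f" for n x
  proof -
    have "L n = (x - y) /\<^sub>R dt - f"
      by (simp flip: that(2))
    then have "dt *\<^sub>R L n = x - y - dt *\<^sub>R f"
      using dt by (simp add: scaleR_diff_right)
    then have "\<theta> *\<^sub>R (dt *\<^sub>R L n) = \<theta> *\<^sub>R (x - y - dt *\<^sub>R f)" by simp
    then have "(dt * \<theta>) *\<^sub>R L n = \<theta> *\<^sub>R x - \<theta> *\<^sub>R y - (dt * \<theta>) *\<^sub>R f"
      by (simp add: scaleR_diff_right mult.commute)
    then show ?thesis unfolding that(1) by (simp add: scaleR_left_diff_distrib)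
  qed
  have "m = m'"
    using inj step[OF m(2,3)] step[OF m'(2,3)] m(1) m'(1)
    unfolding theta_unique_def inj_on_def by metis
  with m(2) m'(2) \<theta> show ?thesis by simp
qed

text \<open>
  The iterates themselves need not be in the domain of \<open>L\<close>, so \<open>L\<close> is never applied to \<open>w i\<close>. The
  argument \<open>p\<close> of \<open>L\<close> that belongs to the sum is assembled from the arguments \<open>m i\<close> in the steps of
  \<open>w\<close> and the argument \<open>m0\<close> in its initial condition; \<open>m 0 - m0\<close> represents \<open>\<theta> w\<^sub>1\<close>, and
  \<open>w\<^sub>1 - \<Delta>t L (m 0 - m0) = F\<close>.
\<close>

lemma theta_scheme_duhamel:
  assumes L: "linear L" and D: "subspace D"
    and inj: "theta_unique j D L \<theta> dt" and \<theta>: "\<theta> \<noteq> 0" and dt: "dt \<noteq> 0"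
    and e: "theta_scheme j D L \<theta> dt K (\<lambda>k. u k *\<^sub>R F) e" "e 0 = 0"
    and w: "theta_scheme j D L \<theta> dt K (\<lambda>k. 0) w" "theta_initial j D L \<theta> dt F (w 0)"
  shows "k \<le> K \<Longrightarrow> e k = dt *\<^sub>R (\<Sum>i<k. u i *\<^sub>R w (k - i))"
proof (induction k)
  case 0
  then show ?case by (simp add: e(2))
next
  case (Suc k)
  then have k: "k < K" and ek: "e k = dt *\<^sub>R (\<Sum>i<k. u i *\<^sub>R w (k - i))" by auto
  obtain m where m: "\<And>i. i < K \<Longrightarrow> m i \<in> D"
      "\<And>i. i < K \<Longrightarrow> j (m i) = \<theta> *\<^sub>R w (Suc i) + (1 - \<theta>) *\<^sub>R w i"
      "\<And>i. i < K \<Longrightarrow> (w (Suc i) - w i) /\<^sub>R dt - L (m i) = 0"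
    using w(1) unfolding theta_scheme_def by metis
  have Lm: "dt *\<^sub>R L (m i) = w (Suc i) - w i" if "i < K" for i
  proof -
    have "L (m i) = (w (Suc i) - w i) /\<^sub>R dt" using m(3)[OF that] by simp
    then show ?thesis using dt by simp
  qed
  obtain m0 where m0: "m0 \<in> D" "j m0 = (1 - \<theta>) *\<^sub>R w 0" "w 0 + dt *\<^sub>R L m0 = F"
    using w(2) unfolding theta_initial_def by blast
  obtain n where n: "n \<in> D" "j n = \<theta> *\<^sub>R e (Suc k) + (1 - \<theta>) *\<^sub>R e k"
      "(e (Suc k) - e k) /\<^sub>R dt - L n = u k *\<^sub>R F"
    using e(1) k unfolding theta_scheme_def by blast
  define z where "z = dt *\<^sub>R (\<Sum>i<Suc k. u i *\<^sub>R w (Suc k - i))"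
  define p where "p = dt *\<^sub>R ((\<Sum>i<k. u i *\<^sub>R m (k - i)) + u k *\<^sub>R (m 0 - m0))"
  have K0: "0 < K" using k by simp
  have Lp: "L p = (\<Sum>i<k. u i *\<^sub>R (w (Suc k - i) - w (k - i))) + u k *\<^sub>R (w 1 - F)"
  proof -
    have "L p = (\<Sum>i<k. u i *\<^sub>R (dt *\<^sub>R L (m (k - i)))) + u k *\<^sub>R (dt *\<^sub>R L (m 0) - dt *\<^sub>R L m0)"
      unfolding p_def
      by (simp add: linear_cmul[OF L] linear_add[OF L] linear_diff[OF L] linear_sum[OF L]
          scaleR_sum_right algebra_simps)
    also have "(\<Sum>i<k. u i *\<^sub>R (dt *\<^sub>R L (m (k - i)))) = (\<Sum>i<k. u i *\<^sub>R (w (Suc k - i) - w (k - i)))"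
      using k by (intro sum.cong refl) (simp add: Lm Suc_diff_le)
    also have "dt *\<^sub>R L (m 0) - dt *\<^sub>R L m0 = w 1 - F"
      using Lm[OF K0] m0(3)[symmetric] by simp
    finally show ?thesis .
  qed
  have zk: "z = dt *\<^sub>R (\<Sum>i<k. u i *\<^sub>R w (Suc k - i)) + (dt * u k) *\<^sub>R w 1"
    unfolding z_def by (simp add: algebra_simps)
  have "e (Suc k) = z"
  proof (rule theta_step_unique[OF inj \<theta> dt n])
    show "p \<in> D"
      unfolding p_def using m(1) m0(1) k
      by (intro subspace_scale[OF D] subspace_add[OF D] subspace_sum[OF D] subspace_diff[OF D]) auto
    have "j p = dt *\<^sub>R ((\<Sum>i<k. u i *\<^sub>R j (m (k - i))) + u k *\<^sub>R (j (m 0) - j m0))"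
      unfolding p_def by (simp add: blinfun.scaleR_right blinfun.add_right blinfun.diff_right blinfun.sum_right)
    also have "(\<Sum>i<k. u i *\<^sub>R j (m (k - i)))
        = (\<Sum>i<k. u i *\<^sub>R (\<theta> *\<^sub>R w (Suc k - i) + (1 - \<theta>) *\<^sub>R w (k - i)))"
      using k by (intro sum.cong refl) (simp add: m(2) Suc_diff_le)
    also have "\<dots> = \<theta> *\<^sub>R (\<Sum>i<k. u i *\<^sub>R w (Suc k - i)) + (1 - \<theta>) *\<^sub>R (\<Sum>i<k. u i *\<^sub>R w (k - i))"
      unfolding scaleR_sum_right sum.distrib[symmetric]
      by (intro sum.cong refl) (simp add: scaleR_add_right mult.commute)
    also have "j (m 0) - j m0 = \<theta> *\<^sub>R w 1"
      using m(2)[OF K0] m0(2) by simp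
    finally show "j p = \<theta> *\<^sub>R z + (1 - \<theta>) *\<^sub>R e k"
      unfolding zk ek by (simp add: scaleR_add_right mult_ac)
    show "(z - e k) /\<^sub>R dt - L p = u k *\<^sub>R F"
      unfolding Lp zk ek using dt
      by (simp add: scaleR_diff_right scaleR_add_right sum_subtractf)
  qed
  then show ?case unfolding z_def .
qed

section \<open>Difference of controlled and uncontrolled solution\<close>

theorem theorem3p8:
  fixes T :: real
    and jVW :: "'v::{real_inner,banach} \<Rightarrow>\<^sub>L 'w::{real_inner,banach}"
    and jWH :: "'w \<Rightarrow>\<^sub>L 'h::{real_inner,banach}"
    and y0 :: 'w and F :: 'h
    and U_fun :: "'u::banach \<Rightarrow> real \<Rightarrow> real"
    and Y_H :: "'y::banach \<Rightarrow> real \<Rightarrow> 'h"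
    and Z_H :: "'z::banach \<Rightarrow> real \<Rightarrow> 'h"
    and Z_W :: "'z \<Rightarrow>\<^sub>L 'w"
    and A :: "'v \<Rightarrow> 'h" and D :: "'v set" and N :: "'v \<Rightarrow> 'h"
    and E :: "'y \<times> 'u \<Rightarrow> 'z"
    and ybar :: 'y and ybar0 :: 'v and C :: "'v \<Rightarrow> 'h"
    and S :: "real \<Rightarrow> 'h \<Rightarrow>\<^sub>L 'h"
  assumes setting: "control_problem T jVW jWH y0 F U_fun Y_H Z_H Z_W A D N E"
    and ybar: "const_in_Y T (jWH o\<^sub>L jVW) Y_H ybar ybar0"
    and C: "C = (\<lambda>x. - frechet_derivative N (at ybar0) x)"
    and S: "generates (jWH o\<^sub>L jVW) D (\<lambda>x. A x + C x) S"
  shows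
    "(\<forall>(v::'y) (d::'y) (u::'u) (w :: real \<Rightarrow> 'h) (wW :: real \<Rightarrow> 'w).
        mild_solution S T (\<lambda>t. A ybar0 - N ybar0) (jWH (y0 - jVW ybar0)) (Y_H v) \<longrightarrow>
        mild_solution S T (\<lambda>t. A ybar0 - N ybar0 + U_fun u t *\<^sub>R F) (jWH (y0 - jVW ybar0)) (Y_H d) \<longrightarrow>
        mild_solution S T (\<lambda>t. 0) F w \<longrightarrow>
        in_L2 T wW \<longrightarrow> (AE t in lebesgue_on {0..T}. jWH (wW t) = w t) \<longrightarrow>
        (\<forall>t\<in>{0..T}. Y_H d t - Y_H v t \<in> jWH ` closure (span (essential_range T wW))))
     \<and>
     (\<forall>(\<theta>::real) (K::nat) (dt::real) (u :: nat \<Rightarrow> real) (d :: nat \<Rightarrow> 'h) (v :: nat \<Rightarrow> 'h) (w :: nat \<Rightarrow> 'h).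
        1/2 \<le> \<theta> \<longrightarrow> \<theta> \<le> 1 \<longrightarrow> 0 < K \<longrightarrow> dt = T / real K \<longrightarrow>
        theta_unique (jWH o\<^sub>L jVW) D (\<lambda>x. A x + C x) \<theta> dt \<longrightarrow>
        theta_scheme (jWH o\<^sub>L jVW) D (\<lambda>x. A x + C x) \<theta> dt K (\<lambda>k. A ybar0 - N ybar0 + u k *\<^sub>R F) d \<longrightarrow>
        d 0 = jWH (y0 - jVW ybar0) \<longrightarrow>
        theta_scheme (jWH o\<^sub>L jVW) D (\<lambda>x. A x + C x) \<theta> dt K (\<lambda>k. A ybar0 - N ybar0) v \<longrightarrow>
        v 0 = jWH (y0 - jVW ybar0) \<longrightarrow>
        theta_scheme (jWH o\<^sub>L jVW) D (\<lambda>x. A x + C x) \<theta> dt K (\<lambda>k. 0) w \<longrightarrow>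
        theta_initial (jWH o\<^sub>L jVW) D (\<lambda>x. A x + C x) \<theta> dt F (w 0) \<longrightarrow>
        (\<forall>k\<le>K. d k - v k \<in> span (w ` {1..k})))"
proof (intro conjI allI impI)
  interpret control_problem T jVW jWH y0 F U_fun Y_H Z_H Z_W A D N E by (rule setting)
  let ?f = "A ybar0 - N ybar0" and ?z0 = "jWH (y0 - jVW ybar0)"
  fix v d :: 'y and u :: 'u and w :: "real \<Rightarrow> 'h" and wW :: "real \<Rightarrow> 'w"
  assume v: "mild_solution S T (\<lambda>t. ?f) ?z0 (Y_H v)"
    and d: "mild_solution S T (\<lambda>t. ?f + U_fun u t *\<^sub>R F) ?z0 (Y_H d)"
    and w: "mild_solution S T (\<lambda>t. 0) F w"
    and wW: "in_L2 T wW" "AE t in lebesgue_on {0..T}. jWH (wW t) = w t"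
  have w_eq: "w t = S t F" if "t \<in> {0..T}" for t
  proof -
    have "((\<lambda>s. 0) has_integral w t - S t F) {0..t}"
      using w that by (simp add: mild_solution_def)
    then show ?thesis by (simp add: has_integral_0_eq)
  qed
  show "\<forall>t\<in>{0..T}. Y_H d t - Y_H v t \<in> jWH ` closure (span (essential_range T wW))"
  proof
    fix t assume t: "t \<in> {0..T}"
    \<comment> \<open>Duhamel's formula: the initial values and the common source cancel.\<close>
    have "((\<lambda>s. S (t - s) (?f + U_fun u s *\<^sub>R F) - S (t - s) ?f)
        has_integral (Y_H d t - S t ?z0 - (Y_H v t - S t ?z0))) {0..t}"
      using d v t unfolding mild_solution_def by (intro has_integral_diff) auto
    then have int: "((\<lambda>s. U_fun u s *\<^sub>R S (t - s) F) has_integral (Y_H d t - Y_H v t)) {0..t}"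
      by (simp add: blinfun.add_right blinfun.scaleR_right)
    have "in_L2 T (U_fun u)"
      using U_L2 unfolding is_L2_space_def L2_representation_def by blast
    then have L2: "in_L2 t (U_fun u)" "in_L2 t (\<lambda>s. wW (t - s))"
      using t wW(1) by (auto intro: in_L2_subinterval in_L2_reflect)
    have "AE s in lebesgue_on {0..T}. jWH (wW s) = S s F"
      using wW(2) AE_space by eventually_elim (simp add: w_eq)
    then have "AE s in lebesgue_on {0..t}. jWH (wW (t - s)) = S (t - s) F"
      by (rule AE_lebesgue_on_reflect) (use t in simp)
    then have eq: "AE s in lebesgue_on {0..t}. jWH (U_fun u s *\<^sub>R wW (t - s)) = U_fun u s *\<^sub>R S (t - s) F"
      by eventually_elim (simp add: blinfun.scaleR_right)
    have "AE s in lebesgue_on {0..t}. wW (t - s) \<in> essential_range T wW"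
      by (rule AE_lebesgue_on_reflect[OF AE_strongly_measurable_in_essential_range])
         (use wW(1) t in \<open>auto simp: in_L2_def\<close>)
    then have "AE s in lebesgue_on {0..t}. U_fun u s *\<^sub>R wW (t - s) \<in> span (essential_range T wW)"
      by eventually_elim (intro span_scale span_base)
    from gauge_integral_in_closure_span[OF _ in_L2_scaleR_integrable[OF L2] int eq this]
    show "Y_H d t - Y_H v t \<in> jWH ` closure (span (essential_range T wW))" by simp
  qed
next
  interpret control_problem T jVW jWH y0 F U_fun Y_H Z_H Z_W A D N E by (rule setting)
  let ?j = "jWH o\<^sub>L jVW" and ?L = "\<lambda>x. A x + C x" and ?f = "A ybar0 - N ybar0"
  fix \<theta> dt :: real and K :: nat and u :: "nat \<Rightarrow> real" and d v w :: "nat \<Rightarrow> 'h"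
  assume \<theta>: "1/2 \<le> \<theta>" and K: "0 < K" "dt = T / real K"
    and inj: "theta_unique ?j D ?L \<theta> dt"
    and d: "theta_scheme ?j D ?L \<theta> dt K (\<lambda>k. ?f + u k *\<^sub>R F) d" "d 0 = jWH (y0 - jVW ybar0)"
    and v: "theta_scheme ?j D ?L \<theta> dt K (\<lambda>k. ?f) v" "v 0 = jWH (y0 - jVW ybar0)"
    and w: "theta_scheme ?j D ?L \<theta> dt K (\<lambda>k. 0) w" "theta_initial ?j D ?L \<theta> dt F (w 0)"
  have dt: "dt \<noteq> 0" using K T_pos by simp
  have "N differentiable (at ybar0)" using N_differentiable ybar by blast
  then have "linear (frechet_derivative N (at ybar0))" by (rule linear_frechet_derivative)
  then have "linear C" unfolding C by (rule linear_compose_neg)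
  then have L: "linear ?L" by (rule linear_compose_add[OF A_linear])
  have e: "theta_scheme ?j D ?L \<theta> dt K (\<lambda>k. u k *\<^sub>R F) (\<lambda>k. d k - v k)"
    using theta_scheme_diff[OF L D_subspace d(1) v(1)] by simp
  fix k assume k: "k \<le> K"
  have "d k - v k = dt *\<^sub>R (\<Sum>i<k. u i *\<^sub>R w (k - i))"
    by (rule theta_scheme_duhamel[OF L D_subspace inj _ dt e _ w k]) (use \<theta> d(2) v(2) in auto)
  also have "\<dots> \<in> span (w ` {1..k})"
    by (intro span_scale span_sum span_base imageI) auto
  finally show "d k - v k \<in> span (w ` {1..k})" .
qed

end
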